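(* Let $\varepsilon>0$ and $\lambda\in[0,1)$, and let $T:X\to X$ be a self mapping of a $G$-metric type space $(X,G,K)$. If $T$ is $(\varepsilon,\lambda)$-uniformly locally contractive and orbitally continuous, and $(X,G,K)$ is $T$-orbitally complete and $\frac{\varepsilon}{2}$-chainable, then $T$ has a unique fixed point.
   Context: A $G$-metric type space $(X,G,K)$ is a nonempty set $X$ with a constant $K>0$ and a function $G:X\times X\times X\to[0,\infty)$ such that: (G1) $G(x,y,z)=0$ if $x=y=z$; (G2) $G(x,x,y)>0$ whenever $x\ne y$; (G3) $G(x,x,y)\le G(x,y,z)$ whenever $z\neq y$; (G4) $G$ is symmetric in its three variables; (G5) $G(x,y,z)\le K[G(x,z_1,z_1)+G(z_1,z_2,z_2)+\cdots+G(z_{n-1},z_n,z_n)+G(z_n,y,z)]$ for all $n\ge1$ and all $x,y,z,z_1,\dots,z_n\in X$. A sequence $(x_n)$ in $X$ is $G$-convergent to $x\in X$ if $\lim_{n,m\to\infty}G(x,x_n,x_m)=0$. It is $G$-Cauchy if for each $\eta>0$ there is $N\in\mathbb N$ with $G(x_n,x_m,x_m)<\eta$ for all $m,n\ge N$. Limits below are in the sense of $G$-convergence. $T$ is orbitally continuous if, for $x\in X$ and $n_i\to\infty$ strictly increasing, $\lim_{i\to\infty}T^{n_i}x=x^*\in X$ implies $Tx^*=\lim_{i\to\infty}TT^{n_i}x$. The space is $T$-orbitally complete if for any $a\in X$ every $G$-Cauchy sequence contained in $\{a,Ta,T^2a,\dots\}$ $G$-converges in $X$. For $x\ne y$, a path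 from $x$ to $y$ is a finite sequence $\{x_0,x_1,\dots,x_n\}$, $n\ge1$, of distinct points of $X$ with $x_0=x$, $x_n=y$. For $\delta>0$, the space is $\delta$-chainable if for any $x\neq y$ in $X$ there is a path $\{x=x_0,\dots,x_n=y\}$ with $G(x_i,x_{i+1},x_{i+1})\le\delta$ for $i=0,\dots,n-1$. $T$ is $(\varepsilon,\lambda)$-uniformly locally contractive if for every $x\in X$, $G(Tu,Tv,Tp)\le\lambda G(u,v,p)$ whenever $u,v,p\in C_G(x,\varepsilon):=\{y\in X: G(x,y,y)\le\varepsilon\}$. *)

theory Defs
  imports Complex_Main "HOL-Library.FuncSet"
begin

text \<open>The carrier is a set; \<open>G\<close> is only constrained on \<open>X\<close>. The two equations in
  \<open>G_sym\<close> are transpositions generating all permutations of the arguments.\<close>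

locale G_metric_type_space =
  fixes X :: "'a set" and G :: "'a \<Rightarrow> 'a \<Rightarrow> 'a \<Rightarrow> real" and K :: real
  assumes nonempty: "X \<noteq> {}"
    and K_pos: "K > 0"
    and G_nonneg: "\<lbrakk>x \<in> X; y \<in> X; z \<in> X\<rbrakk> \<Longrightarrow> G x y z \<ge> 0"
    and G_refl: "x \<in> X \<Longrightarrow> G x x x = 0"
    and G_pos: "\<lbrakk>x \<in> X; y \<in> X; x \<noteq> y\<rbrakk> \<Longrightarrow> G x x y > 0"
    and G_le: "\<lbrakk>x \<in> X; y \<in> X; z \<in> X; z \<noteq> y\<rbrakk> \<Longrightarrow> G x x y \<le> G x y z"
    and G_sym: "\<lbrakk>x \<in> X; y \<in> X; z \<in> X\<rbrakk> \<Longrightarrow> G x y z = G y x z \<and> G x y z = G x z y"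
    and G_polygon: "\<lbrakk>(n::nat) \<ge> 1; x \<in> X; y \<in> X; z \<in> X; \<And>i. i \<in> {1..n} \<Longrightarrow> w i \<in> X\<rbrakk> \<Longrightarrow>
      G x y z \<le> K * (G x (w 1) (w 1) + (\<Sum>i = 1..<n. G (w i) (w (i + 1)) (w (i + 1)))
                     + G (w n) y z)"

definition G_converges ::
    "'a set \<Rightarrow> ('a \<Rightarrow> 'a \<Rightarrow> 'a \<Rightarrow> real) \<Rightarrow> (nat \<Rightarrow> 'a) \<Rightarrow> 'a \<Rightarrow> bool" where
  "G_converges X G s x \<longleftrightarrow> range s \<subseteq> X \<and> x \<in> X \<and>
     ((\<lambda>(n, m). G x (s n) (s m)) \<longlongrightarrow> 0) (sequentially \<times>\<^sub>F sequentially)"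

definition G_Cauchy :: "'a set \<Rightarrow> ('a \<Rightarrow> 'a \<Rightarrow> 'a \<Rightarrow> real) \<Rightarrow> (nat \<Rightarrow> 'a) \<Rightarrow> bool" where
  "G_Cauchy X G s \<longleftrightarrow> range s \<subseteq> X \<and>
     (\<forall>\<eta>>0. \<exists>N. \<forall>m\<ge>N. \<forall>n\<ge>N. G (s n) (s m) (s m) < \<eta>)"

text \<open>A strictly increasing sequence of naturals automatically tends to infinity.\<close>

definition orbitally_continuous ::
    "'a set \<Rightarrow> ('a \<Rightarrow> 'a \<Rightarrow> 'a \<Rightarrow> real) \<Rightarrow> ('a \<Rightarrow> 'a) \<Rightarrow> bool" where
  "orbitally_continuous X G T \<longleftrightarrow>
     (\<forall>x\<in>X. \<forall>k :: nat \<Rightarrow> nat. \<forall>x'\<in>X. strict_mono k \<longrightarrow>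
        G_converges X G (\<lambda>i. (T ^^ k i) x) x' \<longrightarrow>
        G_converges X G (\<lambda>i. T ((T ^^ k i) x)) (T x'))"

definition orbitally_complete ::
    "'a set \<Rightarrow> ('a \<Rightarrow> 'a \<Rightarrow> 'a \<Rightarrow> real) \<Rightarrow> ('a \<Rightarrow> 'a) \<Rightarrow> bool" where
  "orbitally_complete X G T \<longleftrightarrow>
     (\<forall>a\<in>X. \<forall>s. range s \<subseteq> range (\<lambda>n. (T ^^ n) a) \<longrightarrow> G_Cauchy X G s \<longrightarrow>
        (\<exists>x\<in>X. G_converges X G s x))"

definition is_path :: "'a set \<Rightarrow> 'a \<Rightarrow> 'a \<Rightarrow> nat \<Rightarrow> (nat \<Rightarrow> 'a) \<Rightarrow> bool" where
  "is_path X x y n c \<longleftrightarrow>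
     n \<ge> 1 \<and> c ` {0..n} \<subseteq> X \<and> inj_on c {0..n} \<and> c 0 = x \<and> c n = y"

definition chainable ::
    "'a set \<Rightarrow> ('a \<Rightarrow> 'a \<Rightarrow> 'a \<Rightarrow> real) \<Rightarrow> real \<Rightarrow> bool" where
  "chainable X G \<delta> \<longleftrightarrow>
     (\<forall>x\<in>X. \<forall>y\<in>X. x \<noteq> y \<longrightarrow>
        (\<exists>n c. is_path X x y n c \<and> (\<forall>i<n. G (c i) (c (i + 1)) (c (i + 1)) \<le> \<delta>)))"

definition G_cball :: "'a set \<Rightarrow> ('a \<Rightarrow> 'a \<Rightarrow> 'a \<Rightarrow> real) \<Rightarrow> 'a \<Rightarrow> real \<Rightarrow> 'a set" where
  "G_cball X G x \<epsilon> = {y \<in> X. G x y y \<le> \<epsilon>}"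

definition uniformly_locally_contractive ::
    "'a set \<Rightarrow> ('a \<Rightarrow> 'a \<Rightarrow> 'a \<Rightarrow> real) \<Rightarrow> real \<Rightarrow> real \<Rightarrow> ('a \<Rightarrow> 'a) \<Rightarrow> bool" where
  "uniformly_locally_contractive X G \<epsilon> l T \<longleftrightarrow>
     (\<forall>x\<in>X. \<forall>u \<in> G_cball X G x \<epsilon>. \<forall>v \<in> G_cball X G x \<epsilon>. \<forall>p \<in> G_cball X G x \<epsilon>.
        G (T u) (T v) (T p) \<le> l * G u v p)"

end

theory Submission
  imports Defs
begin

text \<open>Write \<open>d x y = G x y y\<close>. Along a chain with steps at most \<open>\<epsilon>/2\<close>, local contractivity
  shrinks every step of the image under \<open>T ^^ m\<close> by the factor \<open>l ^ m\<close>. Since the constant \<open>K\<close>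
  enters the polygon inequality only once, whatever the number of intermediate points,
  \<open>d ((T ^^ m) x) ((T ^^ m) y)\<close> decays geometrically for all \<open>x\<close> and \<open>y\<close>. Taking \<open>y = T x\<close>
  makes every orbit Cauchy, and orbital continuity shows that its limit is fixed; taking two
  fixed points gives uniqueness.\<close>

section \<open>Consequences of the polygon inequality\<close>

context G_metric_type_space
begin

lemma G_chain_le:
  assumes "\<And>i. i \<le> n \<Longrightarrow> c i \<in> X"
  shows "G (c 0) (c n) (c n) \<le> K * (\<Sum>i<n. G (c i) (c (Suc i)) (c (Suc i)))"
proof (cases n)
  case 0
  then show ?thesis using assms[of 0] by (simp add: G_refl)
next
  case (Suc k)
  \<comment> \<open>The endpoint \<open>c n\<close> also serves as the last intermediate point, so
    the closing term of the polygon inequality vanishes.\<close>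
  have "G (c 0) (c n) (c n) \<le> K * (G (c 0) (c 1) (c 1)
      + (\<Sum>i = 1..<n. G (c i) (c (i + 1)) (c (i + 1))) + G (c n) (c n) (c n))"
    using assms Suc by (intro G_polygon) auto
  also have "G (c n) (c n) (c n) = 0"
    using assms by (simp add: G_refl)
  also have "G (c 0) (c 1) (c 1) + (\<Sum>i = 1..<n. G (c i) (c (i + 1)) (c (i + 1)))
      = (\<Sum>i<n. G (c i) (c (Suc i)) (c (Suc i)))"
    using Suc by (simp add: lessThan_atLeast0 sum.atLeast_Suc_lessThan)
  finally show ?thesis by simp
qed

lemma G_triangle:
  assumes "x \<in> X" "y \<in> X" "z \<in> X"
  shows "G x z z \<le> K * (G x y y + G y z z)"
  using G_polygon[of 1 x z z "\<lambda>_. y"] assms by simp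

text \<open>\<open>G x y y\<close> need not be symmetric in \<open>x\<close> and \<open>y\<close>.
  Passing through \<open>y\<close> in \<open>G x y x\<close>, a permutation of
  \<open>G y x x\<close>, leaves two terms that both equal \<open>G x y y\<close>, hence the factor
  2.\<close>

lemma G_swap_le:
  assumes "x \<in> X" "y \<in> X"
  shows "G y x x \<le> 2 * K * G x y y"
proof -
  have "G x y x \<le> K * (G x y y + G y y x)"
    using G_polygon[of 1 x y x "\<lambda>_. y"] assms by simp
  moreover have "G x y x = G y x x" "G y y x = G x y y"
    using assms G_sym by metis+
  ultimately show ?thesis by (simp add: algebra_simps)
qed

lemma G_pos':
  assumes "x \<in> X" "y \<in> X" "x \<noteq> y"
  shows "G x y y > 0"
  using G_pos[of y x] assms G_sym by metis

section \<open>Limits of sequences\<close>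

lemma G_converges_imp_tendsto:
  assumes "G_converges X G s x"
  shows "(\<lambda>n. G x (s n) (s n)) \<longlonglongrightarrow> 0"
proof -
  have "((\<lambda>(n, m). G x (s n) (s m)) \<longlongrightarrow> 0) (sequentially \<times>\<^sub>F sequentially)"
    using assms by (simp add: G_converges_def)
  \<comment> \<open>Along the diagonal both indices tend to infinity, so the double limit restricts
    to it.\<close>
  moreover have "filterlim (\<lambda>n::nat. (n, n)) (sequentially \<times>\<^sub>F sequentially) sequentially"
    by (intro filterlim_Pair filterlim_ident)
  ultimately show ?thesis
    by (auto dest: filterlim_compose)
qed

lemma G_converges_unique:
  assumes "G_converges X G s x" "G_converges X G s y"
  shows "x = y"
proof (rule ccontr)
  assume "x \<noteq> y"
  have X: "x \<in> X" "y \<in> X" "\<And>n. s n \<in> X"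
    using assms by (auto simp: G_converges_def)
  \<comment> \<open>The bound comes from the triangle inequality through \<open>s n\<close>.
    Convergence to \<open>y\<close> controls \<open>G y (s n) (s n)\<close> and not
    \<open>G (s n) y y\<close>, so the latter is swapped at the cost of
    \<open>2 * K\<close>.\<close>
  have "(\<lambda>n. K * (G x (s n) (s n) + 2 * K * G y (s n) (s n))) \<longlonglongrightarrow> K * (0 + 2 * K * 0)"
    by (intro tendsto_intros G_converges_imp_tendsto assms)
  moreover have "G x y y \<le> K * (G x (s n) (s n) + 2 * K * G y (s n) (s n))" for n
  proof -
    have "G x y y \<le> K * (G x (s n) (s n) + G (s n) y y)"
      by (intro G_triangle X)
    also have "\<dots> \<le> K * (G x (s n) (s n) + 2 * K * G y (s n) (s n))"
      using G_swap_le[of y "s n"] X K_pos by (intro mult_left_mono add_left_mono) auto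
    finally show ?thesis .
  qed
  ultimately have "G x y y \<le> 0"
    by (intro LIMSEQ_le_const) auto
  then show False
    using G_pos'[OF X(1,2) \<open>x \<noteq> y\<close>] by simp
qed

text \<open>Orbital continuity yields a limit of the sequence \<open>T ((T ^^ i) a)\<close>, which
  is the orbit shifted by one; this lemma lets it be compared with the limit of the orbit
  itself.\<close>

lemma G_converges_Suc:
  assumes "G_converges X G s x"
  shows "G_converges X G (\<lambda>n. s (Suc n)) x"
proof -
  have "filterlim (map_prod Suc Suc) (sequentially \<times>\<^sub>F sequentially)
          (sequentially \<times>\<^sub>F sequentially)"
    unfolding filterlim_iff eventually_prod_sequentially by (auto intro: le_SucI)
  moreover have "((\<lambda>(n, m). G x (s n) (s m)) \<longlongrightarrow> 0) (sequentially \<times>\<^sub>F sequentially)"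
    using assms by (simp add: G_converges_def)
  ultimately have "((\<lambda>p. (\<lambda>(n, m). G x (s n) (s m)) (map_prod Suc Suc p)) \<longlongrightarrow> 0)
      (sequentially \<times>\<^sub>F sequentially)"
    by (rule filterlim_compose[rotated])
  then show ?thesis
    using assms by (auto simp: G_converges_def split_def)
qed

section \<open>Iterates of a locally contractive map\<close>

context
  fixes T :: "'a \<Rightarrow> 'a" and \<epsilon> l :: real
  assumes \<epsilon>: "\<epsilon> > 0" and l: "0 \<le> l" "l < 1"
    and T: "T \<in> X \<rightarrow> X"
    and contractive: "uniformly_locally_contractive X G \<epsilon> l T"
begin

lemma funpow_in_X: "x \<in> X \<Longrightarrow> (T ^^ m) x \<in> X"
  using T by (induction m) auto

text \<open>The induction sustains itself: since \<open>l ^ m\<close> is at most 1, the iterates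
  stay within \<epsilon> of each other. Both then lie in the closed ball centred at the first one,
  where contractivity applies again.\<close>

lemma funpow_contractive:
  assumes "x \<in> X" "y \<in> X" "G x y y \<le> \<epsilon>"
  shows "G ((T ^^ m) x) ((T ^^ m) y) ((T ^^ m) y) \<le> l ^ m * G x y y"
proof (induction m)
  case (Suc m)
  let ?x = "(T ^^ m) x" and ?y = "(T ^^ m) y"
  have X: "?x \<in> X" "?y \<in> X"
    using assms funpow_in_X by auto
  have "l ^ m * G x y y \<le> 1 * G x y y"
    using l assms by (intro mult_right_mono power_le_one G_nonneg) auto
  with Suc assms have "G ?x ?y ?y \<le> \<epsilon>" by simp
  then have "?x \<in> G_cball X G ?x \<epsilon>" "?y \<in> G_cball X G ?x \<epsilon>"
    using X \<epsilon> by (auto simp: G_cball_def G_refl)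
  then have "G (T ?x) (T ?y) (T ?y) \<le> l * G ?x ?y ?y"
    using contractive X unfolding uniformly_locally_contractive_def by blast
  also have "\<dots> \<le> l * (l ^ m * G x y y)"
    using Suc l by (intro mult_left_mono)
  finally show ?case by (simp add: mult.assoc)
qed simp

lemma funpow_geometric:
  assumes "chainable X G (\<epsilon> / 2)" "x \<in> X" "y \<in> X"
  obtains A where "A \<ge> 0" "\<And>m. G ((T ^^ m) x) ((T ^^ m) y) ((T ^^ m) y) \<le> A * l ^ m"
proof (cases "x = y")
  \<comment> \<open>Chains join only distinct points, so equal points are treated separately, with
    \<open>A = 0\<close>.\<close>
  case True
  then show ?thesis
    using that[of 0] assms funpow_in_X by (simp add: G_refl)
next
  case False
  then obtain n c where path: "is_path X x y n c"
    and c: "\<And>i. i < n \<Longrightarrow> G (c i) (c (Suc i)) (c (Suc i)) \<le> \<epsilon> / 2"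
    using assms unfolding chainable_def by fastforce
  have X: "c i \<in> X" if "i \<le> n" for i
    using path that by (auto simp: is_path_def)
  show ?thesis
  proof (rule that)
    \<comment> \<open>The witness for \<open>A\<close>: \<open>K\<close> times the \<open>n\<close>
      steps of the chain, each bounded by \<epsilon>. It depends on the two points but not on
      \<open>m\<close>.\<close>
    show "K * (real n * \<epsilon>) \<ge> 0"
      using K_pos \<epsilon> by simp
    fix m
    let ?c = "\<lambda>i. (T ^^ m) (c i)"
    have "G ((T ^^ m) x) ((T ^^ m) y) ((T ^^ m) y)
        \<le> K * (\<Sum>i<n. G (?c i) (?c (Suc i)) (?c (Suc i)))"
      using G_chain_le[of n ?c] X funpow_in_X path by (simp add: is_path_def)
    also have "(\<Sum>i<n. G (?c i) (?c (Suc i)) (?c (Suc i))) \<le> (\<Sum>i<n. l ^ m * \<epsilon>)"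
    proof (rule sum_mono)
      fix i assume "i \<in> {..<n}"
      then have *: "c i \<in> X" "c (Suc i) \<in> X" "G (c i) (c (Suc i)) (c (Suc i)) \<le> \<epsilon>"
        using X c[of i] \<epsilon> by auto
      have "G (?c i) (?c (Suc i)) (?c (Suc i)) \<le> l ^ m * G (c i) (c (Suc i)) (c (Suc i))"
        by (rule funpow_contractive[OF *])
      also have "\<dots> \<le> l ^ m * \<epsilon>"
        using * l by (intro mult_left_mono) auto
      finally show "G (?c i) (?c (Suc i)) (?c (Suc i)) \<le> l ^ m * \<epsilon>" .
    qed
    finally show "G ((T ^^ m) x) ((T ^^ m) y) ((T ^^ m) y) \<le> K * (real n * \<epsilon>) * l ^ m"
      using K_pos by (simp add: mult_ac)
  qed
qed

lemma orbit_Cauchy: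
  assumes "chainable X G (\<epsilon> / 2)" "x \<in> X"
  shows "G_Cauchy X G (\<lambda>m. (T ^^ m) x)"
proof -
  let ?s = "\<lambda>m. (T ^^ m) x"
  have X: "?s m \<in> X" for m
    using assms funpow_in_X by simp
  obtain A where A: "A \<ge> 0" "\<And>m. G (?s m) (?s (Suc m)) (?s (Suc m)) \<le> A * l ^ m"
    using funpow_geometric[of x "T x"] assms T by (auto simp: funpow_swap1)
  \<comment> \<open>\<open>A / (1 - l)\<close> is the sum of the geometric series
    \<open>A * l ^ i\<close>. It dominates each partial sum, so the bound is independent of the
    number \<open>p\<close> of steps.\<close>
  define B where "B = K * (A / (1 - l))"
  have B: "B \<ge> 0"
    using A K_pos l by (simp add: B_def)
  have forward: "G (?s m) (?s (m + p)) (?s (m + p)) \<le> B * l ^ m" for m p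
  proof -
    have "G (?s m) (?s (m + p)) (?s (m + p))
        \<le> K * (\<Sum>i<p. G (?s (m + i)) (?s (m + Suc i)) (?s (m + Suc i)))"
      using G_chain_le[of p "\<lambda>i. ?s (m + i)"] X by simp
    also have "\<dots> \<le> K * (\<Sum>i<p. A * l ^ m * l ^ i)"
      using A(2)[of "m + i" for i] K_pos
      by (intro mult_left_mono sum_mono) (auto simp: power_add mult_ac)
    also have "\<dots> = K * (A * l ^ m * (\<Sum>i<p. l ^ i))"
      by (simp add: sum_distrib_left)
    also have "\<dots> \<le> K * (A * l ^ m * (1 / (1 - l)))"
      using l A K_pos sum_le_suminf[of "\<lambda>i. l ^ i" "{..<p}"]
      by (intro mult_left_mono) (auto simp: summable_geometric suminf_geometric)
    finally show ?thesis
      by (simp add: B_def mult_ac)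
  qed
  \<comment> \<open>One constant for both orders of the indices: \<open>B\<close> suffices when
    \<open>n \<le> m\<close>, and the swap gives \<open>2 * K * B\<close> otherwise.\<close>
  define C where "C = (1 + 2 * K) * B"
  have bound: "G (?s n) (?s m) (?s m) \<le> C * l ^ N" if "m \<ge> N" "n \<ge> N" for m n N
  proof -
    have le: "B * l ^ k \<le> B * l ^ N" if "k \<ge> N" for k
      using that B l by (intro mult_left_mono power_decreasing) auto
    have nonneg: "B * l ^ N \<ge> 0"
      using B l by simp
    show ?thesis
    proof (cases "n \<le> m")
      case True
      then have "G (?s n) (?s m) (?s m) \<le> B * l ^ N"
        using forward[of n "m - n"] le[OF \<open>n \<ge> N\<close>] by simp
      also have "\<dots> \<le> C * l ^ N"
        using mult_nonneg_nonneg[of "2 * K", OF _ nonneg] K_pos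
        by (simp add: C_def algebra_simps)
      finally show ?thesis .
    next
      case False
      have "G (?s n) (?s m) (?s m) \<le> 2 * K * G (?s m) (?s n) (?s n)"
        by (intro G_swap_le X)
      also have "\<dots> \<le> 2 * K * (B * l ^ N)"
        using forward[of m "n - m"] le[OF \<open>m \<ge> N\<close>] False K_pos
        by (intro mult_left_mono) auto
      also have "\<dots> \<le> C * l ^ N"
        using nonneg by (simp add: C_def algebra_simps)
      finally show ?thesis .
    qed
  qed
  have "\<exists>N. \<forall>m\<ge>N. \<forall>n\<ge>N. G (?s n) (?s m) (?s m) < \<eta>" if "\<eta> > 0" for \<eta>
  proof -
    have "(\<lambda>N. C * l ^ N) \<longlonglongrightarrow> C * 0"
      using l by (intro tendsto_intros LIMSEQ_power_zero) auto
    then have "\<forall>\<^sub>F N in sequentially. C * l ^ N < \<eta>"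
      using that by (intro order_tendstoD) auto
    then obtain N where "C * l ^ N < \<eta>"
      by (auto simp: eventually_sequentially)
    then show ?thesis
      using bound by (meson le_less_trans)
  qed
  then show ?thesis
    using X by (auto simp: G_Cauchy_def)
qed

section \<open>Uniqueness and existence of the fixed point\<close>

lemma fixed_point_unique:
  assumes "chainable X G (\<epsilon> / 2)" "x \<in> X" "y \<in> X" "T x = x" "T y = y"
  shows "x = y"
proof (rule ccontr)
  assume "x \<noteq> y"
  have fixed: "(T ^^ m) x = x" "(T ^^ m) y = y" for m
    using assms by (induction m) auto
  \<comment> \<open>The iterates leave both points in place, so the decaying bound holds for one
    constant distance.\<close>
  obtain A where A: "\<And>m. G x y y \<le> A * l ^ m"
    using funpow_geometric[OF assms(1-3)] fixed by metis
  have "(\<lambda>m. A * l ^ m) \<longlonglongrightarrow> A * 0"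
    using l by (intro tendsto_intros LIMSEQ_power_zero) auto
  then have "G x y y \<le> 0"
    using A by (intro LIMSEQ_le_const) auto
  then show False
    using G_pos'[OF assms(2,3) \<open>x \<noteq> y\<close>] by simp
qed

lemma fixed_point_exists:
  assumes "chainable X G (\<epsilon> / 2)" "orbitally_continuous X G T" "orbitally_complete X G T"
  shows "\<exists>x\<in>X. T x = x"
proof -
  obtain a where a: "a \<in> X"
    using nonempty by blast
  let ?s = "\<lambda>m. (T ^^ m) a"
  obtain x where x: "x \<in> X" "G_converges X G ?s x"
    using assms(3) a orbit_Cauchy[OF assms(1) a] unfolding orbitally_complete_def by blast
  \<comment> \<open>The whole orbit converges, so orbital continuity is used with the identity as
    index sequence.\<close>
  have "strict_mono (\<lambda>i::nat. i)"
    by (simp add: strict_mono_def)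
  then have "G_converges X G (\<lambda>i. T (?s i)) (T x)"
    using assms(2) a x unfolding orbitally_continuous_def by blast
  moreover have "G_converges X G (\<lambda>i. T (?s i)) x"
    using G_converges_Suc[OF x(2)] by simp
  ultimately show ?thesis
    using G_converges_unique x by blast
qed

end

end

theorem theorem3p20:
  fixes X :: "'a set" and G :: "'a \<Rightarrow> 'a \<Rightarrow> 'a \<Rightarrow> real" and K \<epsilon> l :: real and T :: "'a \<Rightarrow> 'a"
  assumes "G_metric_type_space X G K"
    and "\<epsilon> > 0"
    and "0 \<le> l" and "l < 1"
    and "T \<in> X \<rightarrow> X"
    and "uniformly_locally_contractive X G \<epsilon> l T"
    and "orbitally_continuous X G T"
    and "orbitally_complete X G T"
    and "chainable X G (\<epsilon> / 2)"
  shows "\<exists>!x. x \<in> X \<and> T x = x"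
proof -
  interpret G_metric_type_space X G K by fact
  show ?thesis
    using fixed_point_exists[OF assms(2-6,9,7,8)] fixed_point_unique[OF assms(2-6,9)]
    by blast
qed

end
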